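(* Let $G$ be a finite simple graph. There exists an orientation $G^\sigma$ of $G$ such that $S_p(G^\sigma)=iS_p(G)$, where $i^2=-1$, if and only if $G$ is bipartite.
   Context: An orientation $G^\sigma$ of a simple graph $G$ with vertex set $\{v_1,\dots,v_n\}$ assigns to each edge one of its two directions. The skew adjacency matrix $A_s(G^\sigma)=(a_{ij})$ is the $n\times n$ matrix with $a_{ij}=1$ if $(v_i,v_j)$ is an arc of $G^\sigma$, $a_{ij}=-1$ if $(v_j,v_i)$ is an arc of $G^\sigma$, and $a_{ij}=0$ otherwise. $A(G)$ is the usual $(0,1)$ adjacency matrix of $G$. The permanent of $M=(m_{ij})$ is $\mathrm{per}(M)=\sum_{\pi\in S_n}\prod_{k=1}^{n}m_{k\pi(k)}$. The permanental polynomials are $\pi(G^\sigma,x)=\mathrm{per}(xI-A_s(G^\sigma))$ and $\pi(G,x)=\mathrm{per}(xI-A(G))$. The per-spectra $S_p(G^\sigma)$ and $S_p(G)$ are the multisets of complex roots (with multiplicity) of $\pi(G^\sigma,x)$ and $\pi(G,x)$ respectively. For a multiset $S$ of complex numbers, $iS$ is the multiset obtained by multiplying each element by $i$. *)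

theory Defs
  imports "Graph_Theory.Pair_Digraph" "Jordan_Normal_Form.Char_Poly"
begin

text \<open>
  A finite simple graph is a \<open>pair_graph\<close>: a finite, loopless, symmetric digraph without
  parallel arcs, where the undirected edge \<open>uv\<close> is the pair of arcs \<open>(u, v)\<close>, \<open>(v, u)\<close>.
  An oriented graph has the same record type but carries just one of the two arcs.
\<close>

definition is_orientation :: "'a pair_pre_digraph \<Rightarrow> 'a pair_pre_digraph \<Rightarrow> bool" where
  "is_orientation H G \<longleftrightarrow>
     pverts H = pverts G \<and>
     (\<forall>u v. (u, v) \<in> parcs G \<longleftrightarrow> (u, v) \<in> parcs H \<or> (v, u) \<in> parcs H) \<and>
     (\<forall>u v. \<not> ((u, v) \<in> parcs H \<and> (v, u) \<in> parcs H))"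

definition bipartite :: "'a pair_pre_digraph \<Rightarrow> bool" where
  "bipartite G \<longleftrightarrow>
     (\<exists>U W. U \<union> W = pverts G \<and> U \<inter> W = {} \<and> parcs G \<subseteq> U \<times> W \<union> W \<times> U)"

text \<open>The list \<open>vs\<close> enumerates the vertices; its \<open>i\<close>-th entry labels row and column \<open>i\<close>.\<close>

definition adjacency_mat :: "'a list \<Rightarrow> 'a pair_pre_digraph \<Rightarrow> complex mat" where
  "adjacency_mat vs G = mat (length vs) (length vs)
     (\<lambda>(i, j). if (vs ! i, vs ! j) \<in> parcs G then 1 else 0)"

definition skew_adjacency_mat :: "'a list \<Rightarrow> 'a pair_pre_digraph \<Rightarrow> complex mat" where
  "skew_adjacency_mat vs H = mat (length vs) (length vs)
     (\<lambda>(i, j). if (vs ! i, vs ! j) \<in> parcs H then 1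
               else if (vs ! j, vs ! i) \<in> parcs H then - 1 else 0)"

definition permanent :: "'a :: comm_semiring_1 mat \<Rightarrow> 'a" where
  "permanent M = (\<Sum>p | p permutes {0..<dim_row M}. \<Prod>k = 0..<dim_row M. M $$ (k, p k))"

text \<open>\<open>char_poly_matrix A\<close> is the polynomial matrix \<open>x I - A\<close>.\<close>

definition permanental_poly :: "'a :: comm_ring_1 mat \<Rightarrow> 'a poly" where
  "permanental_poly A = permanent (char_poly_matrix A)"

definition per_spectrum :: "complex mat \<Rightarrow> complex multiset" where
  "per_spectrum A = proots (permanental_poly A)"

end

theory Submission
  imports Defs
begin

text \<open>
  Both permanental polynomials are monic of degree \<open>n\<close>, so the spectral condition says
  \<open>\<pi>(H, \<i> x) = \<i>\<^sup>n \<pi>(G, x)\<close>. If \<open>G\<close> is bipartite, direct every edge from one class to the other.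
  Conversely, transposing a skew matrix gives \<open>\<pi>(H, - x) = (- 1)\<^sup>n \<pi>(H, x)\<close>, so \<open>\<pi>(G, x)\<close> has the same
  parity. At \<open>x = 1\<close> this reads \<open>per (I + A) = per (I - A)\<close>; as all products in \<open>per (I + A)\<close>
  are nonnegative, no permutation can move an odd number of vertices, each along an edge. Hence
  \<open>G\<close> has no odd cycle.
\<close>

section \<open>Permanental polynomials\<close>

lemma poly_permanental_poly:
  fixes f :: "nat \<times> nat \<Rightarrow> 'a :: comm_ring_1"
  shows "poly (permanental_poly (mat n n f)) x =
    (\<Sum>p | p permutes {0..<n}. \<Prod>k = 0..<n. (if p k = k then x else 0) - f (k, p k))"
  unfolding permanental_poly_def permanent_def poly_sum poly_prod
  by (intro sum.cong prod.cong)
     (auto simp: char_poly_matrix_def permutes_in_image)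

text \<open>Only the identity permutation contributes in degree \<open>n\<close>: its term is the
  product of the \<open>n\<close> monic linear diagonal entries, while any other permutation moves
  some \<open>k\<close> and picks up a constant off-diagonal factor there.\<close>

lemma monic_permanental_poly:
  fixes A :: "'a :: idom mat"
  assumes A: "A \<in> carrier_mat n n"
  shows "lead_coeff (permanental_poly A) = 1" "degree (permanental_poly A) = n"
proof -
  define F where "F p k = char_poly_matrix A $$ (k, p k)" for p k
  have F: "F p k = (if p k = k then [: - (A $$ (k, k)), 1:] else [: - (A $$ (k, p k)) :])"
    if "k < n" "p permutes {0..<n}" for p k
  proof -
    have "p k < n" using that permutes_in_image[of p "{0..<n}" k] by simp
    then show ?thesis using A that unfolding F_def char_poly_matrix_def by auto
  qed
  have small: "degree (\<Prod>k = 0..<n. F p k) < n" if p: "p permutes {0..<n}" and "p \<noteq> id" for p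
  proof -
    have "\<exists>k\<in>{0..<n}. p k \<noteq> k"
      using that by (metis eq_id_iff permutes_not_in)
    then obtain k where k: "k \<in> {0..<n}" "p k \<noteq> k" by blast
    have "degree (\<Prod>k = 0..<n. F p k) \<le> (\<Sum>k = 0..<n. degree (F p k))"
      using degree_prod_sum_le[of "{0..<n}" "F p"] by (simp add: o_def)
    also have "\<dots> < (\<Sum>k = 0..<n. 1)"
      by (rule sum_strict_mono_ex1) (use F[OF _ p] k in auto)
    finally show ?thesis by simp
  qed
  have monic: "(\<Prod>k = 0..<n. F id k) = (\<Prod>k = 0..<n. [: - (A $$ (k, k)), 1:])"
    by (intro prod.cong) (use F[OF _ permutes_id] in auto)
  have deg_id: "degree (\<Prod>k = 0..<n. F id k) = n"
    unfolding monic by (subst degree_prod_eq_sum_degree) auto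
  have lead_id: "coeff (\<Prod>k = 0..<n. F id k) n = 1"
  proof -
    have "lead_coeff (\<Prod>k = 0..<n. F id k) = 1"
      unfolding monic lead_coeff_prod by simp
    then show ?thesis by (simp only: deg_id)
  qed
  let ?P = "{p. p permutes {0..<n}}"
  have fin: "finite ?P" by (simp add: finite_permutations)
  have id: "id \<in> ?P" by (simp add: permutes_id)
  have eq: "permanental_poly A = (\<Sum>p\<in>?P. \<Prod>k = 0..<n. F p k)"
    using A unfolding permanental_poly_def permanent_def F_def by (simp add: char_poly_matrix_def)
  have "coeff (permanental_poly A) n = (\<Sum>p\<in>?P. if p = id then 1 else 0)"
    unfolding eq coeff_sum
    by (intro sum.cong) (use lead_id small in \<open>auto intro!: coeff_eq_0\<close>)
  also have "\<dots> = 1" using fin id by simp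
  finally have 1: "coeff (permanental_poly A) n = 1" .
  have "degree (permanental_poly A) \<le> n"
    unfolding eq
  proof (rule degree_sum_le[OF fin])
    show "degree (\<Prod>k = 0..<n. F p k) \<le> n" if "p \<in> ?P" for p
      using small[of p] deg_id that by (cases "p = id") auto
  qed
  moreover have "n \<le> degree (permanental_poly A)"
    using 1 by (intro le_degree) auto
  ultimately show deg: "degree (permanental_poly A) = n" by simp
  show "lead_coeff (permanental_poly A) = 1" using 1 deg by simp
qed

lemma monic_complex_poly_proots:
  fixes p :: "complex poly"
  assumes "lead_coeff p = 1"
  shows "p = (\<Prod>z\<in>#proots p. [:- z, 1:])"
  using assms
proof (induction "degree p" arbitrary: p)
  case 0
  then have "p = 1" by (metis degree_eq_zeroE lead_coeff_pCons(2) one_pCons)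
  then show ?case by simp
next
  case (Suc n)
  obtain z where "poly p z = 0"
    using Suc.hyps(2) fundamental_theorem_of_algebra[of p] constant_degree[of p] by auto
  then obtain q where q: "p = [:- z, 1:] * q" by (auto simp: poly_eq_0_iff_dvd dvd_def)
  have q0: "q \<noteq> 0" using Suc.hyps(2) q by auto
  have "degree p = Suc (degree q)" unfolding q using q0 by (subst degree_mult_eq) auto
  moreover have "lead_coeff q = 1" using Suc.prems unfolding q lead_coeff_mult by simp
  ultimately have "q = (\<Prod>z\<in>#proots q. [:- z, 1:])" using Suc.hyps by auto
  moreover have "proots p = add_mset z (proots q)"
    unfolding q using q0 by (subst proots_mult) auto
  ultimately show ?case using q by simp
qed

lemma proots_prod_mset_linear:
  fixes f :: "'b \<Rightarrow> 'a :: idom"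
  shows "proots (\<Prod>z\<in>#M. [:- f z, 1:]) = image_mset f M"
proof (induction M)
  case (add z M)
  have "(\<Prod>z\<in>#M. [:- f z, 1:]) \<noteq> 0" by (auto simp: prod_mset_zero_iff)
  then have "proots ([:- f z, 1:] * (\<Prod>z\<in>#M. [:- f z, 1:])) = {#f z#} + image_mset f M"
    by (subst proots_mult) (auto simp: add)
  then show ?case by (simp del: mult_pCons_left)
qed simp

text \<open>Turns the equality of spectra into a polynomial identity that can be evaluated at
  points. The monic polynomial \<open>r\<close> with the rotated roots satisfies the identity; equal
  roots force \<open>q = r\<close>, and so does the identity, since \<open>\<i> * x\<close> takes
  every complex value.\<close>

lemma proots_rotate_iff:
  fixes p q :: "complex poly"
  assumes p: "lead_coeff p = 1" "degree p = n" and q: "lead_coeff q = 1" "degree q = n"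
  shows "proots q = image_mset (\<lambda>z. \<i> * z) (proots p)
    \<longleftrightarrow> (\<forall>x. poly q (\<i> * x) = \<i> ^ n * poly p x)" (is "?L \<longleftrightarrow> ?R")
proof -
  define r where "r = (\<Prod>z\<in>#proots p. [:- (\<i> * z), 1:])"
  have r: "poly r (\<i> * x) = \<i> ^ n * poly p x" for x
  proof -
    have "poly r (\<i> * x) = (\<Prod>z\<in>#proots p. \<i> * (x - z))"
      unfolding r_def poly_prod_mset by (simp add: algebra_simps image_mset.compositionality o_def)
    also have "\<dots> = \<i> ^ size (proots p) * (\<Prod>z\<in>#proots p. x - z)"
      by (simp add: prod_mset.distrib)
    also have "(\<Prod>z\<in>#proots p. x - z) = poly p x"
      by (subst (2) monic_complex_poly_proots[OF p(1)])
         (simp add: poly_prod_mset image_mset.compositionality o_def)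
    finally show ?thesis by (simp add: size_proots_complex p)
  qed
  have proots_r: "proots r = image_mset (\<lambda>z. \<i> * z) (proots p)"
    unfolding r_def by (rule proots_prod_mset_linear)
  show ?thesis
  proof
    assume L: ?L
    have "q = r"
      by (subst monic_complex_poly_proots[OF q(1)])
         (simp add: L r_def image_mset.compositionality o_def)
    then show ?R using r by simp
  next
    assume R: ?R
    have "poly q y = poly r y" for y
      \<comment> \<open>The point \<open>- \<i> * y\<close> is chosen because multiplication by
        \<open>\<i>\<close> sends it to \<open>y\<close>.\<close>
      using R r spec[OF R, of "- \<i> * y"] r[of "- \<i> * y"] by simp
    then have "q = r" by (simp flip: poly_eq_poly_eq_iff add: fun_eq_iff)
    then show ?L using proots_r by simp
  qed
qed

text \<open>The permanent is invariant under transposition, and for a skew matrix A the transpose of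
  \<open>- x I - A\<close> is \<open>- (x I - A)\<close>, so each of the \<open>n\<close> rows
  contributes a factor -1.\<close>

lemma poly_permanental_poly_skew:
  fixes f :: "nat \<times> nat \<Rightarrow> 'a :: comm_ring_1"
  assumes skew: "\<And>i j. f (j, i) = - f (i, j)"
  shows "poly (permanental_poly (mat n n f)) (- x) = (- 1) ^ n * poly (permanental_poly (mat n n f)) x"
proof -
  have "poly (permanental_poly (mat n n f)) (- x) =
      (\<Sum>p | p permutes {0..<n}. \<Prod>k = 0..<n. (if Hilbert_Choice.inv p k = k then - x else 0) - f (k, Hilbert_Choice.inv p k))"
    unfolding poly_permanental_poly by (rule sum_permutations_inverse)
  also have "\<dots> = (\<Sum>p | p permutes {0..<n}.
      (- 1) ^ n * (\<Prod>k = 0..<n. (if p k = k then x else 0) - f (k, p k)))"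
  proof (intro sum.cong refl)
    fix p assume "p \<in> {p. p permutes {0..<n}}"
    then have p: "p permutes {0..<n}" by simp
    \<comment> \<open>Reindexing the factors by \<open>p\<close> replaces the entry at row
      \<open>k\<close> by \<open>f (p k, k)\<close>, which skewness turns into
      \<open>- f (k, p k)\<close>.\<close>
    have "(\<Prod>k = 0..<n. (if Hilbert_Choice.inv p k = k then - x else 0) - f (k, Hilbert_Choice.inv p k)) =
        (\<Prod>k = 0..<n. (if Hilbert_Choice.inv p (p k) = p k then - x else 0) - f (p k, Hilbert_Choice.inv p (p k)))"
      by (rule prod.permute[OF p, unfolded o_def])
    also have "\<dots> = (\<Prod>k = 0..<n. (- 1) * ((if p k = k then x else 0) - f (k, p k)))"
      by (intro prod.cong) (auto simp: permutes_inverses[OF p] skew[of "p _"])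
    also have "\<dots> = (- 1) ^ n * (\<Prod>k = 0..<n. (if p k = k then x else 0) - f (k, p k))"
      by (subst prod.distrib) simp
    finally show "(\<Prod>k = 0..<n. (if Hilbert_Choice.inv p k = k then - x else 0) - f (k, Hilbert_Choice.inv p k)) =
      (- 1) ^ n * (\<Prod>k = 0..<n. (if p k = k then x else 0) - f (k, p k))" .
  qed
  finally show ?thesis unfolding poly_permanental_poly by (simp add: sum_distrib_left)
qed

section \<open>Odd closed walks and bipartiteness\<close>

text \<open>Each component gets a base point, and \<open>x\<close> is coloured by the parity of a
  walk from the base point to \<open>x\<close>. The parity is well defined, since going out along
  one walk and back along another gives a closed walk, which must be even.\<close>

lemma two_colouring_if_no_odd_closed_walk:
  assumes sym: "sym R" and no_odd: "\<And>x k. odd k \<Longrightarrow> (x, x) \<notin> R ^^ k"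
  obtains c :: "'a \<Rightarrow> bool" where "\<And>x y. (x, y) \<in> R \<Longrightarrow> c x \<noteq> c y"
proof
  define r where "r x = (SOME y. (y, x) \<in> R\<^sup>*)" for x
  define c where "c x \<longleftrightarrow> (\<exists>k. even k \<and> (r x, x) \<in> R ^^ k)" for x
  have r: "(r x, x) \<in> R\<^sup>*" for x
    unfolding r_def by (rule someI[of _ x]) simp
  have sym_pow: "(y, x) \<in> R ^^ k" if "(x, y) \<in> R ^^ k" for x y k
    using that
  proof (induction k arbitrary: y)
    case (Suc k)
    then obtain z where "(z, x) \<in> R ^^ k" "(y, z) \<in> R" using sym by (auto dest: symD)
    then show ?case by (rule relpow_Suc_I2[rotated])
  qed auto
  have unique: "even k \<longleftrightarrow> even l" if "(a, x) \<in> R ^^ k" "(a, x) \<in> R ^^ l" for a x k l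
  proof -
    have "(a, a) \<in> R ^^ (k + l)"
      using that(1) sym_pow[OF that(2)] by (auto simp: relpow_add)
    then show ?thesis using no_odd[of "k + l"] by auto
  qed
  have c_iff: "c x \<longleftrightarrow> even k" if "(r x, x) \<in> R ^^ k" for x k
    using that unique[OF that] unfolding c_def by blast
  fix x y assume xy: "(x, y) \<in> R"
  then have yx: "(y, x) \<in> R" using sym by (auto dest: symD)
  \<comment> \<open>Adjacent points are reachable from the same points, so \<open>SOME\<close>
    selects the same base point for both.\<close>
  have "(a, x) \<in> R\<^sup>* \<longleftrightarrow> (a, y) \<in> R\<^sup>*" for a
    using xy yx by (meson rtrancl.rtrancl_into_rtrancl)
  then have "r x = r y" unfolding r_def by simp
  moreover obtain k where k: "(r x, x) \<in> R ^^ k" using r rtrancl_imp_relpow by metis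
  moreover have "(r x, y) \<in> R ^^ Suc k" using k xy by auto
  ultimately show "c x \<noteq> c y" using c_iff[of x k] c_iff[of y "Suc k"] by auto
qed

text \<open>A shortest odd closed walk is a cycle: a repeated vertex would split it into two closed
  walks, one of which is odd.\<close>

lemma odd_closed_walk_imp_odd_cycle:
  assumes "odd k" "(x, x) \<in> R ^^ k"
  obtains f :: "nat \<Rightarrow> 'a" and m where "odd m" "inj_on f {0..<m}" "f m = f 0"
    "\<And>i. i < m \<Longrightarrow> (f i, f (Suc i)) \<in> R"
proof -
  define P where "P m \<longleftrightarrow> odd m \<and> (\<exists>x. (x, x) \<in> R ^^ m)" for m
  define m where "m = (LEAST m. P m)"
  have "P k" using assms unfolding P_def by blast
  then have "P m" unfolding m_def by (rule LeastI)
  have least: "m \<le> l" if "P l" for l using that unfolding m_def by (rule Least_le)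
  obtain x f where m: "odd m" and f: "f 0 = x" "f m = x" "\<And>i. i < m \<Longrightarrow> (f i, f (Suc i)) \<in> R"
    using \<open>P m\<close> unfolding P_def relpow_fun_conv by blast
  have walk: "(f i, f (i + l)) \<in> R ^^ l" if "i + l \<le> m" for i l
    unfolding relpow_fun_conv by (rule exI[of _ "\<lambda>t. f (i + t)"]) (use f that in auto)
  have "f i \<noteq> f j" if ij: "i < j" "j < m" for i j
  proof
    assume eq: "f i = f j"
    have "(f i, f i) \<in> R ^^ (j - i)" using walk[of i "j - i"] ij eq by simp
    moreover have "(x, f i) \<in> R ^^ i" using walk[of 0 i] ij f by simp
    moreover have "(f i, x) \<in> R ^^ (m - j)" using walk[of j "m - j"] ij f eq by simp
    ultimately have "(f i, f i) \<in> R ^^ (j - i)" "(x, x) \<in> R ^^ (i + (m - j))"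
      by (auto simp: relpow_add)
    moreover have "odd (j - i) \<or> odd (i + (m - j))"
      using m ij by presburger
    ultimately have "m \<le> j - i \<or> m \<le> i + (m - j)"
      using least unfolding P_def by blast
    then show False using ij by linarith
  qed
  then have "inj_on f {0..<m}"
    by (intro linorder_inj_onI) auto
  then show ?thesis using that m f by simp
qed

text \<open>The permutation rotates the cycle by one place. Surjectivity onto the finite set of
  cycle vertices suffices for bijectivity.\<close>

lemma cycle_imp_permutation:
  assumes inj: "inj_on f {0..<m}" and "f m = f 0" and R: "\<And>i. i < m \<Longrightarrow> (f i, f (Suc i)) \<in> R"
  obtains p where "p permutes f ` {0..<m}" "\<And>v. v \<in> f ` {0..<m} \<Longrightarrow> (v, p v) \<in> R"
proof -
  let ?C = "f ` {0..<m}"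
  define p where "p v = (if v \<in> ?C then f (Suc (the_inv_into {0..<m} f v)) else v)" for v
  have p: "p (f i) = f (Suc i)" if "i < m" for i
    using that the_inv_into_f_f[OF inj, of i] by (simp add: p_def)
  have "?C \<subseteq> p ` ?C"
  proof
    fix v assume "v \<in> ?C"
    then obtain i where i: "i < m" "v = f i" by auto
    show "v \<in> p ` ?C"
    proof (cases i)
      case 0
      \<comment> \<open>The predecessor of \<open>f 0\<close> is \<open>f (m - 1)\<close>, because
        the cycle closes up at \<open>f m = f 0\<close>.\<close>
      then have "v = p (f (m - 1))" using p[of "m - 1"] i \<open>f m = f 0\<close> by simp
      then show ?thesis using i by auto
    next
      case (Suc j)
      then have "v = p (f j)" using p[of j] i by simp
      then show ?thesis using i Suc by auto
    qed
  qed
  moreover have "p ` ?C \<subseteq> ?C"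
  proof
    fix v assume "v \<in> p ` ?C"
    then obtain i where i: "i < m" "v = f (Suc i)" using p by auto
    show "v \<in> ?C" using i \<open>f m = f 0\<close> by (cases "Suc i = m") auto
  qed
  ultimately have "bij_betw p ?C ?C"
    by (metis bij_betw_def endo_inj_surj eq_card_imp_inj_on finite_atLeastLessThan finite_imageI
        subset_antisym)
  then have "p permutes ?C" by (rule bij_imp_permutes) (simp add: p_def)
  moreover have "(v, p v) \<in> R" if "v \<in> ?C" for v using that p R by auto
  ultimately show ?thesis using that by blast
qed

text \<open>Links permutations, which permanents can detect, to colourings: an odd closed walk would
  contain an odd cycle, and rotating that cycle would be a permutation with a support of odd
  size.\<close>

lemma two_colouring_if_even_supports:
  assumes "sym R" "irrefl R"
    and even: "\<And>p S. p permutes S \<Longrightarrow> finite S \<Longrightarrow> S \<subseteq> Field R \<Longrightarrow>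
      (\<And>v. v \<in> S \<Longrightarrow> (v, p v) \<in> R) \<Longrightarrow> even (card S)"
  obtains c :: "'a \<Rightarrow> bool" where "\<And>x y. (x, y) \<in> R \<Longrightarrow> c x \<noteq> c y"
proof (rule two_colouring_if_no_odd_closed_walk[OF \<open>sym R\<close>])
  fix x and k :: nat assume k: "odd k"
  show "(x, x) \<notin> R ^^ k"
  proof
    assume "(x, x) \<in> R ^^ k"
    with k obtain f m where m: "odd m" and inj: "inj_on f {0..<m}" and f: "f m = f 0"
      "\<And>i. i < m \<Longrightarrow> (f i, f (Suc i)) \<in> R"
      by (rule odd_closed_walk_imp_odd_cycle) blast
    obtain p where "p permutes f ` {0..<m}" "\<And>v. v \<in> f ` {0..<m} \<Longrightarrow> (v, p v) \<in> R"
      using cycle_imp_permutation[OF inj f] by blast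
    moreover from this have "f ` {0..<m} \<subseteq> Field R" by (auto simp: Field_def)
    ultimately have "even (card (f ` {0..<m}))" by (intro even) auto
    then show False using m card_image[OF inj] by simp
  qed
qed (use that in blast)

section \<open>The per-spectrum of an orientation\<close>

text \<open>The difference of the two sides is twice the number of permutations \<open>p\<close> moving an odd number
  of points, all of them along \<open>R\<close>.\<close>

lemma even_support_if_permanents_eq:
  fixes R :: "(nat \<times> nat) set"
  defines "a \<equiv> \<lambda>e. if e \<in> R then 1 else 0 :: complex"
  assumes "irrefl R" and sub: "S \<subseteq> {0..<n}" and p: "p permutes S" "\<And>v. v \<in> S \<Longrightarrow> (v, p v) \<in> R"
    and eq: "(\<Sum>p | p permutes {0..<n}. \<Prod>k = 0..<n. (if p k = k then 1 else 0) + a (k, p k)) =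
      (\<Sum>p | p permutes {0..<n}. \<Prod>k = 0..<n. (if p k = k then 1 else 0) - a (k, p k))"
  shows "even (card S)"
proof -
  let ?P = "{p. p permutes {0..<n}}"
  \<comment> \<open>The factors of \<open>per (I + A)\<close> are \<open>b\<close>, those of
    \<open>per (I - A)\<close> are \<open>s * b\<close>. Since \<open>s\<close> is -1 exactly at
    moved points, its product is the parity sign of the number of moved points.\<close>
  define b :: "(nat \<Rightarrow> nat) \<Rightarrow> nat \<Rightarrow> real" where "b p k = (if p k = k \<or> (k, p k) \<in> R then 1 else 0)" for p k
  define s :: "(nat \<Rightarrow> nat) \<Rightarrow> nat \<Rightarrow> real" where "s p k = (if p k = k then 1 else - 1)" for p k
  have [simp]: "(k, k) \<notin> R" for k using \<open>irrefl R\<close> by (simp add: irrefl_def)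
  have plus: "(if p k = k then 1 else 0) + a (k, p k) = of_real (b p k)" for p k
    by (auto simp: a_def b_def)
  have minus: "(if p k = k then 1 else 0) - a (k, p k) = of_real (s p k * b p k)" for p k
    by (auto simp: a_def b_def s_def)
  have "(\<Sum>p\<in>?P. \<Prod>k = 0..<n. b p k) = (\<Sum>p\<in>?P. \<Prod>k = 0..<n. s p k * b p k)"
    using eq unfolding plus minus of_real_prod[symmetric] of_real_sum[symmetric] of_real_eq_iff .
  then have "(\<Sum>p\<in>?P. (1 - (\<Prod>k = 0..<n. s p k)) * (\<Prod>k = 0..<n. b p k)) = 0"
    by (simp add: prod.distrib left_diff_distrib sum_subtractf)
  moreover have "(1 - (\<Prod>k = 0..<n. s p k)) * (\<Prod>k = 0..<n. b p k) \<ge> 0" for p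
  proof (intro mult_nonneg_nonneg prod_nonneg)
    have "\<bar>\<Prod>k = 0..<n. s p k\<bar> = 1" unfolding abs_prod by (rule prod.neutral) (simp add: s_def)
    then show "1 - (\<Prod>k = 0..<n. s p k) \<ge> 0" by linarith
  qed (simp add: b_def)
  \<comment> \<open>Nonnegative terms with sum zero all vanish, in particular the term of the given
    \<open>p\<close>.\<close>
  moreover have pP: "p \<in> ?P" using permutes_subset[OF p(1) sub] by simp
  ultimately have 0: "(1 - (\<Prod>k = 0..<n. s p k)) * (\<Prod>k = 0..<n. b p k) = 0"
    by (subst (asm) sum_nonneg_eq_0_iff) (auto simp: finite_permutations)
  have moved: "p k \<noteq> k" if "k \<in> S" for k
    using p(2)[OF that] by auto
  \<comment> \<open>On \<open>S\<close> the permutation moves along \<open>R\<close> and elsewhere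
    it fixes points, so no factor vanishes and its sign must be 1.\<close>
  have "b p k = 1" for k
    using p permutes_not_in[OF p(1), of k] by (cases "k \<in> S") (auto simp: b_def)
  with 0 have "(\<Prod>k = 0..<n. s p k) = 1" by simp
  also have "(\<Prod>k = 0..<n. s p k) = (\<Prod>k\<in>S. s p k)"
    using sub permutes_not_in[OF p(1)] by (intro prod.mono_neutral_right) (auto simp: s_def)
  also have "\<dots> = (\<Prod>k\<in>S. - 1)"
    using moved by (intro prod.cong) (auto simp: s_def)
  finally show ?thesis by (cases "even (card S)") auto
qed

text \<open>For the orientation from one colour class to the other, the skew adjacency matrix is
  \<open>\<i>\<close> times a diagonal conjugate of the adjacency matrix, and permanents are invariant under
  diagonal conjugation.\<close>

lemma poly_permanental_poly_diagonal_conjugate: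
  fixes f g :: "nat \<times> nat \<Rightarrow> 'a :: field" and d :: "nat \<Rightarrow> 'a"
  assumes d: "\<And>k. d k \<noteq> 0" and g: "\<And>k l. k < n \<Longrightarrow> l < n \<Longrightarrow> g (k, l) = c * (d k * f (k, l) / d l)"
  shows "poly (permanental_poly (mat n n g)) (c * x) = c ^ n * poly (permanental_poly (mat n n f)) x"
proof -
  have "(\<Prod>k = 0..<n. (if p k = k then c * x else 0) - g (k, p k)) =
      c ^ n * (\<Prod>k = 0..<n. (if p k = k then x else 0) - f (k, p k))" if p: "p permutes {0..<n}" for p
  proof -
    have "(\<Prod>k = 0..<n. (if p k = k then c * x else 0) - g (k, p k)) =
        (\<Prod>k = 0..<n. c * (d k / d (p k)) * ((if p k = k then x else 0) - f (k, p k)))"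
    proof (intro prod.cong refl)
      fix k assume "k \<in> {0..<n}"
      then have "k < n" "p k < n" using permutes_in_image[OF p, of k] by auto
      then show "(if p k = k then c * x else 0) - g (k, p k) =
          c * (d k / d (p k)) * ((if p k = k then x else 0) - f (k, p k))"
        using g[of k "p k"] d[of k] by (auto simp: algebra_simps)
    qed
    also have "\<dots> = c ^ n * ((\<Prod>k = 0..<n. d k) / (\<Prod>k = 0..<n. d (p k))) *
        (\<Prod>k = 0..<n. (if p k = k then x else 0) - f (k, p k))"
      by (simp add: prod.distrib prod_dividef)
    \<comment> \<open>Every index occurs once as a row and once as a column, so the diagonal factors
      cancel.\<close>
    also have "(\<Prod>k = 0..<n. d (p k)) = (\<Prod>k = 0..<n. d k)"
      using prod.permute[OF p, of d] by (simp add: o_def)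
    finally show ?thesis using d by simp
  qed
  then show ?thesis unfolding poly_permanental_poly by (simp add: sum_distrib_left)
qed

theorem theorem4p5:
  fixes G :: "'a pair_pre_digraph" and vs :: "'a list"
  assumes "pair_graph G"
    and "distinct vs" and "set vs = pverts G"
  shows "(\<exists>H. is_orientation H G \<and>
            per_spectrum (skew_adjacency_mat vs H) =
              image_mset (\<lambda>z. \<i> * z) (per_spectrum (adjacency_mat vs G)))
         \<longleftrightarrow> bipartite G"
proof -
  interpret pair_graph G by fact
  have symG: "(v, u) \<in> parcs G" if "(u, v) \<in> parcs G" for u v
    using that arcs_symmetric by blast
  have loopG: "(v, v) \<notin> parcs G" for v using pair_no_loops[of "(v, v)"] by auto
  have vertsG: "u \<in> pverts G" "v \<in> pverts G" if "(u, v) \<in> parcs G" for u v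
    using that in_arcsD1 in_arcsD2 by auto
  define n where "n = length vs"
  define fA where "fA = (\<lambda>(i, j). if (vs ! i, vs ! j) \<in> parcs G then 1 else 0 :: complex)"
  define fS where "fS H = (\<lambda>(i, j). if (vs ! i, vs ! j) \<in> parcs H then 1
      else if (vs ! j, vs ! i) \<in> parcs H then - 1 else 0 :: complex)" for H :: "'a pair_pre_digraph"
  have A: "adjacency_mat vs G = mat n n fA" and S: "skew_adjacency_mat vs H = mat n n (fS H)" for H
    by (auto simp: adjacency_mat_def skew_adjacency_mat_def n_def fA_def fS_def)
  let ?PG = "permanental_poly (mat n n fA)" and ?PH = "\<lambda>H. permanental_poly (mat n n (fS H))"
  have spec: "per_spectrum (skew_adjacency_mat vs H) =
      image_mset (\<lambda>z. \<i> * z) (per_spectrum (adjacency_mat vs G)) \<longleftrightarrow>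
      (\<forall>x. poly (?PH H) (\<i> * x) = \<i> ^ n * poly ?PG x)" for H
    unfolding per_spectrum_def A S
    by (rule proots_rotate_iff) (auto intro!: monic_permanental_poly)
  show ?thesis
  proof
    assume "\<exists>H. is_orientation H G \<and> per_spectrum (skew_adjacency_mat vs H) =
      image_mset (\<lambda>z. \<i> * z) (per_spectrum (adjacency_mat vs G))"
    then obtain H where H: "is_orientation H G" and eq: "\<And>x. poly (?PH H) (\<i> * x) = \<i> ^ n * poly ?PG x"
      unfolding spec by blast
    have "fS H (j, i) = - fS H (i, j)" for i j
      using H by (auto simp: fS_def is_orientation_def)
    then have skew: "poly (?PH H) (- x) = (- 1) ^ n * poly (?PH H) x" for x
      by (rule poly_permanental_poly_skew)
    \<comment> \<open>The values of \<open>?PG\<close> at -1 and 1 correspond to those of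
      \<open>?PH H\<close> at \<open>- \<i>\<close> and \<open>\<i>\<close>, which skewness
      relates.\<close>
    have "\<i> ^ n * poly ?PG (- 1) = \<i> ^ n * ((- 1) ^ n * poly ?PG 1)"
      using eq[of "- 1"] eq[of 1] skew[of \<i>] by (simp only: mult_minus_right mult_1_right mult.left_commute)
    then have "poly ?PG (- 1) = (- 1) ^ n * poly ?PG 1" by (subst (asm) mult_left_cancel) simp_all
    then have "(- 1) ^ n * poly ?PG (- 1) = poly ?PG 1"
      by (simp only: mult.assoc[symmetric] power_mult_distrib[symmetric]) simp
    \<comment> \<open>One factor -1 is put into each row, which turns \<open>per (- I - A)\<close>
      into \<open>per (I + A)\<close>.\<close>
    moreover have "(- 1) ^ n * poly ?PG (- 1) = (\<Sum>p | p permutes {0..<n}.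
        \<Prod>k = 0..<n. (- 1) * ((if p k = k then - 1 else 0) - fA (k, p k)))"
      unfolding poly_permanental_poly sum_distrib_left by (subst prod.distrib) simp
    moreover have "\<dots> = (\<Sum>p | p permutes {0..<n}.
        \<Prod>k = 0..<n. (if p k = k then 1 else 0) + fA (k, p k))"
      by (intro sum.cong prod.cong) auto
    ultimately have per_eq: "(\<Sum>p | p permutes {0..<n}.
        \<Prod>k = 0..<n. (if p k = k then 1 else 0) + fA (k, p k)) =
      (\<Sum>p | p permutes {0..<n}. \<Prod>k = 0..<n. (if p k = k then 1 else 0) - fA (k, p k))"
      unfolding poly_permanental_poly by simp
    \<comment> \<open>The edges are carried over from vertices to indices, where the permutations
      act.\<close>
    define R where "R = {(i, j). i < n \<and> j < n \<and> (vs ! i, vs ! j) \<in> parcs G}"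
    have fA: "fA (k, p k) = (if (k, p k) \<in> R then 1 else 0)" if "k < n" "p permutes {0..<n}" for k p
      using that permutes_in_image[of p "{0..<n}" k] by (auto simp: fA_def R_def)
    have R: "sym R" "irrefl R" using symG loopG by (auto simp: R_def sym_def irrefl_def)
    obtain c :: "nat \<Rightarrow> bool" where c: "\<And>i j. (i, j) \<in> R \<Longrightarrow> c i \<noteq> c j"
    proof (rule two_colouring_if_even_supports[OF R])
      fix p T assume T: "p permutes T" "T \<subseteq> Field R" "\<And>v. v \<in> T \<Longrightarrow> (v, p v) \<in> R"
      show "even (card T)"
      proof (rule even_support_if_permanents_eq[OF R(2) _ T(1,3)])
        show "T \<subseteq> {0..<n}" using T(2) by (auto simp: R_def Field_def)
        show "(\<Sum>p | p permutes {0..<n}. \<Prod>k = 0..<n.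
            (if p k = k then 1 else 0) + (if (k, p k) \<in> R then 1 else 0 :: complex)) =
          (\<Sum>p | p permutes {0..<n}. \<Prod>k = 0..<n.
            (if p k = k then 1 else 0) - (if (k, p k) \<in> R then 1 else 0))"
          (is "?plus = ?minus")
        proof -
          have "?plus = (\<Sum>p | p permutes {0..<n}. \<Prod>k = 0..<n. (if p k = k then 1 else 0) + fA (k, p k))"
            by (intro sum.cong prod.cong refl arg_cong2[of _ _ _ _ "(+)"]) (simp add: fA)
          also note per_eq
          also have "(\<Sum>p | p permutes {0..<n}. \<Prod>k = 0..<n. (if p k = k then 1 else 0) - fA (k, p k)) = ?minus"
            by (intro sum.cong prod.cong refl arg_cong2[of _ _ _ _ "(-)"]) (simp add: fA)
          finally show ?thesis .
        qed
      qed
    qed (rule that, assumption)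
    have inR: "\<exists>i j. (i, j) \<in> R \<and> u = vs ! i \<and> v = vs ! j" if uv: "(u, v) \<in> parcs G" for u v
    proof -
      obtain i j where "i < n" "u = vs ! i" "j < n" "v = vs ! j"
        using vertsG[OF uv] unfolding \<open>set vs = pverts G\<close>[symmetric] in_set_conv_nth n_def by blast
      then show ?thesis using uv unfolding R_def by blast
    qed
    show "bipartite G"
      unfolding bipartite_def
    proof (intro exI conjI)
      let ?U = "{vs ! i | i. i < n \<and> c i}" and ?W = "{vs ! i | i. i < n \<and> \<not> c i}"
      show "?U \<union> ?W = pverts G"
        unfolding \<open>set vs = pverts G\<close>[symmetric] n_def set_conv_nth by blast
      \<comment> \<open>By distinctness a vertex has a single index, hence a single colour.\<close>
      show "?U \<inter> ?W = {}"
        using \<open>distinct vs\<close> by (auto simp: n_def nth_eq_iff_index_eq)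
      show "parcs G \<subseteq> ?U \<times> ?W \<union> ?W \<times> ?U"
      proof
        fix e assume "e \<in> parcs G"
        then obtain i j where "(i, j) \<in> R" "e = (vs ! i, vs ! j)" using inR by (cases e) blast
        then show "e \<in> ?U \<times> ?W \<union> ?W \<times> ?U" using c[of i j] by (auto simp: R_def)
      qed
    qed
  next
    assume "bipartite G"
    then obtain U W where UW: "U \<union> W = pverts G" "U \<inter> W = {}" "parcs G \<subseteq> U \<times> W \<union> W \<times> U"
      unfolding bipartite_def by blast
    define H where "H = \<lparr>pverts = pverts G, parcs = parcs G \<inter> U \<times> W\<rparr>"
    have orient: "is_orientation H G"
      using UW symG unfolding is_orientation_def H_def by auto
    \<comment> \<open>With 1 on \<open>U\<close> and \<open>\<i>\<close> on \<open>W\<close>, an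
      edge from \<open>U\<close> to \<open>W\<close> gets the entry
      \<open>\<i> * 1 / \<i> = 1\<close>, and the reverse direction gets
      \<open>\<i> * \<i> / 1 = - 1\<close>, as the orientation \<open>H\<close> requires.\<close>
    define d where "d k = (if vs ! k \<in> U then 1 else \<i>)" for k
    have "poly (?PH H) (\<i> * x) = \<i> ^ n * poly ?PG x" for x
    proof (rule poly_permanental_poly_diagonal_conjugate)
      show "d k \<noteq> 0" for k by (simp add: d_def)
      show "fS H (k, l) = \<i> * (d k * fA (k, l) / d l)" for k l
        using UW symG[of "vs ! k" "vs ! l"] symG[of "vs ! l" "vs ! k"]
        by (auto simp: fS_def H_def d_def fA_def)
    qed
    with orient show "\<exists>H. is_orientation H G \<and> per_spectrum (skew_adjacency_mat vs H) =
        image_mset (\<lambda>z. \<i> * z) (per_spectrum (adjacency_mat vs G))"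
      unfolding spec by blast
  qed
qed

end
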